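(* Let $H$ be a real Hilbert space, $C\subseteq H$ a nonempty bounded closed convex set with $\operatorname{diam}(C)\le M$, where $M$ is a positive integer, let $T:C\to C$ be a demicontinuous (single-valued) pseudocontraction which is moreover uniformly continuous on $C$ with modulus $\omega$, and let $x_1,z\in C$. Let $(\lambda_n)_{n\in\mathbb{N}}$, $(\theta_n)_{n\in\mathbb{N}}$ be sequences in $[0,1]$ which are acceptably paired with moduli $\varphi_1,\varphi_2,\varphi_3,f,n_0,\delta$ and satisfy $\lambda_n(1+\theta_n)\le 1$ for all $n$. Let $(y_i)_{i\in\mathbb{N}}$ be a sequence in $C$ with $y_i=\frac{1}{1+\theta_i}Ty_i+\frac{\theta_i}{1+\theta_i}z$ for all $i$, and suppose $(y_i)$ is metastable with rate $\Psi$. Define $(x_n)_{n\ge1}$ by $x_{n+1}=(1-\lambda_n)x_n+\lambda_nTx_n+\lambda_n\theta_n(z-x_n)$. For $\eta>0$ and $h:\mathbb{N}\to\mathbb{N}$ define $c:=\exp(-\delta/2)$, $\tilde\eta:=\frac{1-c}{16}\eta$, $k_0:=\max\{\varphi_2(\eta^2/6M^2),\varphi_3(\eta^2/12M^2)\}$, $d:=\max\{f(k_0),\lceil\log_c(\eta/8M)\rceil\}$, $n_1:=\max\{n_0,\varphi_1(\delta/2),\varphi_2(\tilde\eta^2/4M^2),\varphi_3(\tilde\eta^2/8M^2)\}$, $\tilde h(n):=\bigl(f(n)+h(f(n))\bigr)^*-n$, $h_d(n):=d+n_1+1+\tilde h(n+n_1+d+1)$, $(h_d)_f(n):=f(n+h_d(n))-n$,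 and $\Phi(\eta,h):=f\bigl(\Psi(\tilde\eta,(h_d)_f)+n_1+d+1\bigr)$. Now for $\varepsilon>0$ and $g:\mathbb{N}\to\mathbb{N}$ let $b:=f\bigl((\varphi_1(\varepsilon/3M))^*+1\bigr)$, $g_b(n):=b+g(n+b)$, and $$\Delta(g,\varepsilon):=\Phi\bigl(\min\{\varepsilon/3,\omega(\varepsilon/3M)\},\,g_b\bigr)+b.$$ Then for all $\varepsilon>0$ and all $g:\mathbb{N}\to\mathbb{N}$ there exists $n\le\Delta(g,\varepsilon)$ such that for all $i,j\in[n;n+g(n)]$, $$\|x_i-x_j\|\le\varepsilon\quad\text{and}\quad\|x_i-Tx_i\|\le\varepsilon.$$
   Context: For $n,m\in\mathbb{N}$, $[n;n+m]:=\{n,n+1,\dots,n+m\}$. $T:C\to C$ is a pseudocontraction if $\langle Tu-Tv,u-v\rangle\le\|u-v\|^2$ for all $u,v\in C$; it is demicontinuous if it is continuous from the norm topology to the weak topology. $\omega:(0,\infty)\to(0,\infty)$ is a modulus of uniform continuity of $T$ on $C$: for all $\varepsilon>0$ and $u,v\in C$, $\|u-v\|\le\omega(\varepsilon)$ implies $\|Tu-Tv\|\le\varepsilon$. A sequence $(a_n)$ is metastable with rate $\Psi:(0,\infty)\times\mathbb{N}^{\mathbb{N}}\to\mathbb{N}$ if for all $\varepsilon>0$ and all $g:\mathbb{N}\to\mathbb{N}$ there is $n\le\Psi(\varepsilon,g)$ with $\|a_i-a_j\|\le\varepsilon$ for all $i,j\in[n;n+g(n)]$. Two sequences $(\lambda_n),(\theta_n)$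 in $[0,1]$ are acceptably paired with moduli $\varphi_1,\varphi_2,\varphi_3:(0,\infty)\to\mathbb{N}$, $f:\mathbb{N}\to\mathbb{N}$, $n_0\in\mathbb{N}$ and $\delta>0$ if $(\theta_n)$ is nonincreasing and: (i) $\theta_n\le\varepsilon$ for all $\varepsilon>0$ and $n\ge\varphi_1(\varepsilon)$; (ii) $f(n+1)\ge f(n)+1$ for all $n$; (iii) $\theta_{f(n)}\sum_{j=f(n)}^{f(n+1)}\lambda_j\ge\delta$ for all $n\ge n_0$; (iv) $(\theta_{f(n)}-\theta_{f(n+1)})\sum_{j=f(n)}^{f(n+1)}\lambda_j\le\varepsilon$ for all $\varepsilon>0$ and $n\ge\varphi_2(\varepsilon)$; (v) $\sum_{j=f(n)}^{f(n+1)}\lambda_j^2\le\varepsilon$ for all $\varepsilon>0$ and $n\ge\varphi_3(\varepsilon)$. For $k\ge f(0)$, $k^*:=\max\{n\in\mathbb{N}:f(n)\le k\}$. *)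

theory Defs
  imports "HOL-Analysis.Analysis"
begin

definition pseudocontraction_on :: "'a::real_inner set \<Rightarrow> ('a \<Rightarrow> 'a) \<Rightarrow> bool" where
  "pseudocontraction_on C T \<longleftrightarrow>
     (\<forall>u\<in>C. \<forall>v\<in>C. (T u - T v) \<bullet> (u - v) \<le> (norm (u - v))\<^sup>2)"

definition weak_topology :: "'a::real_normed_vector topology" where
  "weak_topology =
     topology_generated_by {\<phi> -` U |(\<phi> :: 'a \<Rightarrow> real) U. bounded_linear \<phi> \<and> open U}"

definition demicontinuous_on :: "'a::real_normed_vector set \<Rightarrow> ('a \<Rightarrow> 'a) \<Rightarrow> bool" where
  "demicontinuous_on C T \<longleftrightarrow> continuous_map (top_of_set C) weak_topology T"

definition uniform_continuity_modulus_on ::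
    "'a::real_normed_vector set \<Rightarrow> ('a \<Rightarrow> 'a) \<Rightarrow> (real \<Rightarrow> real) \<Rightarrow> bool" where
  "uniform_continuity_modulus_on C T \<omega> \<longleftrightarrow>
     (\<forall>\<epsilon>>0. \<omega> \<epsilon> > 0 \<and>
        (\<forall>u\<in>C. \<forall>v\<in>C. norm (u - v) \<le> \<omega> \<epsilon> \<longrightarrow> norm (T u - T v) \<le> \<epsilon>))"

definition metastable_with_rate ::
    "(nat \<Rightarrow> 'a::real_normed_vector) \<Rightarrow> (real \<Rightarrow> (nat \<Rightarrow> nat) \<Rightarrow> nat) \<Rightarrow> bool" where
  "metastable_with_rate a \<Psi> \<longleftrightarrow>
     (\<forall>\<epsilon>>0. \<forall>g. \<exists>n\<le>\<Psi> \<epsilon> g. \<forall>i\<in>{n..n + g n}. \<forall>j\<in>{n..n + g n}. norm (a i - a j) \<le> \<epsilon>)"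

definition acceptably_paired ::
    "(nat \<Rightarrow> real) \<Rightarrow> (nat \<Rightarrow> real) \<Rightarrow> (real \<Rightarrow> nat) \<Rightarrow> (real \<Rightarrow> nat) \<Rightarrow> (real \<Rightarrow> nat) \<Rightarrow>
     (nat \<Rightarrow> nat) \<Rightarrow> nat \<Rightarrow> real \<Rightarrow> bool" where
  "acceptably_paired lam \<theta> \<phi>\<^sub>1 \<phi>\<^sub>2 \<phi>\<^sub>3 f n\<^sub>0 \<delta> \<longleftrightarrow>
     (\<forall>n. lam n \<in> {0..1}) \<and> (\<forall>n. \<theta> n \<in> {0..1}) \<and> \<delta> > 0 \<and>
     decseq \<theta> \<and>
     (\<forall>\<epsilon>>0. \<forall>n\<ge>\<phi>\<^sub>1 \<epsilon>. \<theta> n \<le> \<epsilon>) \<and>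
     (\<forall>n. f (n + 1) \<ge> f n + 1) \<and>
     (\<forall>n\<ge>n\<^sub>0. \<theta> (f n) * (\<Sum>j = f n..f (n + 1). lam j) \<ge> \<delta>) \<and>
     (\<forall>\<epsilon>>0. \<forall>n\<ge>\<phi>\<^sub>2 \<epsilon>. (\<theta> (f n) - \<theta> (f (n + 1))) * (\<Sum>j = f n..f (n + 1). lam j) \<le> \<epsilon>) \<and>
     (\<forall>\<epsilon>>0. \<forall>n\<ge>\<phi>\<^sub>3 \<epsilon>. (\<Sum>j = f n..f (n + 1). (lam j)\<^sup>2) \<le> \<epsilon>)"

text \<open>
  The number \<open>k\<^sup>*\<close> is only meaningful for \<open>k \<ge> f 0\<close>; below \<open>f 0\<close>, where the set is empty for
  increasing \<open>f\<close>, the value is fixed to be \<open>0\<close>.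
\<close>

definition lower_index :: "(nat \<Rightarrow> nat) \<Rightarrow> nat \<Rightarrow> nat" where
  "lower_index f k = (if f 0 \<le> k then Max {n. f n \<le> k} else 0)"

text \<open>
  For \<open>f\<close> strictly increasing, the two subtractions on \<^typ>\<open>nat\<close> below never truncate:
  \<open>(f n + h (f n))\<^sup>* \<ge> n\<close> and \<open>f m \<ge> m\<close>. The rounded logarithm may be negative; truncating it at
  \<open>0\<close> does not change the maximum with the natural number \<open>f k\<^sub>0\<close>.
\<close>

definition Phi_rate ::
    "nat \<Rightarrow> (real \<Rightarrow> nat) \<Rightarrow> (real \<Rightarrow> nat) \<Rightarrow> (real \<Rightarrow> nat) \<Rightarrow> (nat \<Rightarrow> nat) \<Rightarrow> nat \<Rightarrow> real \<Rightarrow>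
     (real \<Rightarrow> (nat \<Rightarrow> nat) \<Rightarrow> nat) \<Rightarrow> real \<Rightarrow> (nat \<Rightarrow> nat) \<Rightarrow> nat" where
  "Phi_rate M \<phi>\<^sub>1 \<phi>\<^sub>2 \<phi>\<^sub>3 f n\<^sub>0 \<delta> \<Psi> \<eta> h =
     (let c = exp (- \<delta> / 2);
          \<eta>' = (1 - c) / 16 * \<eta>;
          k\<^sub>0 = max (\<phi>\<^sub>2 (\<eta>\<^sup>2 / (6 * (real M)\<^sup>2))) (\<phi>\<^sub>3 (\<eta>\<^sup>2 / (12 * (real M)\<^sup>2)));
          d = max (f k\<^sub>0) (nat \<lceil>log c (\<eta> / (8 * real M))\<rceil>);
          n\<^sub>1 = Max {n\<^sub>0, \<phi>\<^sub>1 (\<delta> / 2),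
                      \<phi>\<^sub>2 (\<eta>'\<^sup>2 / (4 * (real M)\<^sup>2)), \<phi>\<^sub>3 (\<eta>'\<^sup>2 / (8 * (real M)\<^sup>2))};
          h' = (\<lambda>n. lower_index f (f n + h (f n)) - n);
          h\<^sub>d = (\<lambda>n. d + n\<^sub>1 + 1 + h' (n + n\<^sub>1 + d + 1));
          h\<^sub>d\<^sub>f = (\<lambda>n. f (n + h\<^sub>d n) - n)
      in f (\<Psi> \<eta>' h\<^sub>d\<^sub>f + n\<^sub>1 + d + 1))"

definition Delta_rate ::
    "nat \<Rightarrow> (real \<Rightarrow> real) \<Rightarrow> (real \<Rightarrow> nat) \<Rightarrow> (real \<Rightarrow> nat) \<Rightarrow> (real \<Rightarrow> nat) \<Rightarrow> (nat \<Rightarrow> nat) \<Rightarrow>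
     nat \<Rightarrow> real \<Rightarrow> (real \<Rightarrow> (nat \<Rightarrow> nat) \<Rightarrow> nat) \<Rightarrow> (nat \<Rightarrow> nat) \<Rightarrow> real \<Rightarrow> nat" where
  "Delta_rate M \<omega> \<phi>\<^sub>1 \<phi>\<^sub>2 \<phi>\<^sub>3 f n\<^sub>0 \<delta> \<Psi> g \<epsilon> =
     (let b = f (lower_index f (\<phi>\<^sub>1 (\<epsilon> / (3 * real M))) + 1);
          g\<^sub>b = (\<lambda>n. b + g (n + b))
      in Phi_rate M \<phi>\<^sub>1 \<phi>\<^sub>2 \<phi>\<^sub>3 f n\<^sub>0 \<delta> \<Psi> (min (\<epsilon> / 3) (\<omega> (\<epsilon> / (3 * real M)))) g\<^sub>b + b)"

end

theory Submission imports Defs begin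

text \<open>
  Put \<open>A = I - T\<close>, which is monotone, so that \<open>A y\<^sub>i + \<theta>\<^sub>i (y\<^sub>i - z) = 0\<close> and
  \<open>x\<^sub>j\<^sub>+\<^sub>1 = x\<^sub>j - \<lambda>\<^sub>j (A x\<^sub>j + \<theta>\<^sub>j (x\<^sub>j - z))\<close>. Expanding the square against a fixed \<open>y\<^sub>i\<close> with
  \<open>i = f n\<close> and summing over the block \<open>[f n; f (n + 1)]\<close> shows that the squared distance to \<open>y\<^sub>i\<close>
  contracts by \<open>exp (- \<delta>)\<close> over the block and never grows inside it, up to errors controlled by
  \<open>\<phi>\<^sub>2\<close> and \<open>\<phi>\<^sub>3\<close>. On a stretch where the \<open>y\<^sub>i\<close> are metastable, \<open>\<parallel>x\<^bsub>f n\<^esub> - y\<^bsub>f n\<^esub>\<parallel>\<close> therefore decays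
  geometrically, and \<open>x\<close> inherits the metastability of \<open>y\<close>. Asymptotic regularity follows since
  \<open>\<parallel>y\<^sub>i - T y\<^sub>i\<parallel> = \<theta>\<^sub>i \<parallel>z - y\<^sub>i\<parallel>\<close>.
\<close>

section \<open>Scalar recursions with errors\<close>

text \<open>The term \<open>e / (1 - c)\<close> is the fixed point of the affine map with slope
  \<open>c\<close> and shift \<open>e\<close>, so it reproduces itself. The step is assumed only
  below \<open>S\<close> because metastability controls only finite stretches.\<close>

lemma geometric_recursion_bound:
  fixes b :: "nat \<Rightarrow> real"
  assumes "0 \<le> c" "c < 1" "0 \<le> e"
    and step: "\<And>s. s < S \<Longrightarrow> b (Suc s) \<le> c * b s + e"
  shows "s \<le> S \<Longrightarrow> b s \<le> c ^ s * b 0 + e / (1 - c)"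
proof (induction s)
  case 0
  then show ?case using assms by simp
next
  case (Suc s)
  have "b (Suc s) \<le> c * (c ^ s * b 0 + e / (1 - c)) + e"
    using step[of s] Suc mult_left_mono[OF _ \<open>0 \<le> c\<close>, of "b s" "c ^ s * b 0 + e / (1 - c)"]
    by force
  also have "\<dots> = c ^ Suc s * b 0 + (c * e + (1 - c) * e) / (1 - c)"
    using \<open>c < 1\<close> by (simp add: field_simps)
  finally show ?case by (simp add: algebra_simps)
qed

text \<open>Since \<open>1 + u \<le> exp u\<close>, the contraction factors combine into one
  exponential; the errors are multiplied by factors at most 1 and simply add up.\<close>

lemma exp_recursion_bound:
  fixes a l e :: "nat \<Rightarrow> real"
  assumes "\<And>j. 0 \<le> a j" "\<And>j. 0 \<le> l j" "\<And>j. 0 \<le> e j" "0 \<le> t" "s \<le> r"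
    and step: "\<And>j. s \<le> j \<Longrightarrow> j < r \<Longrightarrow> a (Suc j) \<le> (1 - t * l j) * a j + e j"
  shows "a r \<le> exp (- (t * (\<Sum>j = s..<r. l j))) * a s + (\<Sum>j = s..<r. e j)"
  using \<open>s \<le> r\<close> step
proof (induction r rule: dec_induct)
  case base
  then show ?case by simp
next
  case (step r)
  let ?P = "exp (- (t * (\<Sum>j = s..<r. l j)))" and ?E = "\<Sum>j = s..<r. e j"
  have nonneg: "0 \<le> ?E" "0 \<le> t * l r" using assms by (auto intro: sum_nonneg)
  have IH: "a r \<le> ?P * a s + ?E" using step by simp
  have "a (Suc r) \<le> (1 - t * l r) * a r + e r" using step by simp
  \<comment> \<open>The factor \<open>1 - t * l r\<close> may be negative, so the induction
    hypothesis is inserted only after passing to the exponential.\<close>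
  also have "(1 - t * l r) * a r \<le> exp (- (t * l r)) * a r"
    using exp_ge_add_one_self[of "- (t * l r)"] assms(1) by (intro mult_right_mono) auto
  also have "\<dots> \<le> exp (- (t * l r)) * (?P * a s + ?E)"
    using IH by (intro mult_left_mono) auto
  also have "\<dots> \<le> exp (- (t * l r)) * ?P * a s + ?E"
    using nonneg mult_right_mono[of "exp (- (t * l r))" 1 ?E] by (simp add: algebra_simps)
  also have "exp (- (t * l r)) * ?P = exp (- (t * (\<Sum>j = s..<Suc r. l j)))"
    using step by (simp add: exp_add[symmetric] algebra_simps)
  finally show ?case using step by simp
qed

section \<open>Block indices\<close>

text \<open>Strict monotonicity gives \<open>n \<le> f n\<close>, so the set under
  \<open>Max\<close> is finite. The last bound also covers \<open>k < f 0\<close>, through the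
  default value 0.\<close>

lemma
  assumes "strict_mono f"
  shows lower_index_ge: "f n \<le> k \<Longrightarrow> n \<le> lower_index f k"
    and f_lower_index_le: "f 0 \<le> k \<Longrightarrow> f (lower_index f k) \<le> k"
    and less_f_Suc_lower_index: "k < f (Suc (lower_index f k))"
proof -
  have fin: "finite {n. f n \<le> k}" for k
    by (rule finite_subset[of _ "{..k}"]) (use seq_suble[OF assms] le_trans in blast, simp)
  have mono: "f i \<le> f j" if "i \<le> j" for i j
    using that assms by (simp add: strict_mono_less_eq)
  show ge: "n \<le> lower_index f k" if "f n \<le> k" for n
    using that Max_ge[OF fin[of k], of n] mono[of 0 n] by (simp add: lower_index_def)
  show "f 0 \<le> k \<Longrightarrow> f (lower_index f k) \<le> k"
    using Max_in[OF fin[of k]] unfolding lower_index_def by fastforce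
  show "k < f (Suc (lower_index f k))"
    using ge[of "Suc (lower_index f k)"] by (meson Suc_n_not_le_n not_le)
qed

section \<open>One step against a fixed reference point\<close>

text \<open>The point \<open>p\<close> solves the regularised equation for \<open>t\<close>, while
  the step uses \<open>t' \<le> t\<close>. Monotonicity of \<open>I - T\<close> bounds the inner
  product of the direction \<open>w\<close> with \<open>u - p\<close> from below by
  \<open>t * (norm (u - p))\<^sup>2\<close>, up to the mismatch
  \<open>(t - t') * M\<^sup>2\<close>.\<close>

lemma pseudocontraction_step:
  fixes u p z :: "'a::real_inner"
  assumes "pseudocontraction_on C T" "u \<in> C" "p \<in> C"
    and p: "p - T p = t *\<^sub>R (z - p)"
    and "0 \<le> l" "0 \<le> t'" "t' \<le> t" "t' \<le> 1" "norm (u - T u) \<le> M" "norm (u - z) \<le> M" "norm (u - p) \<le> M"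
  shows "(norm ((1 - l) *\<^sub>R u + l *\<^sub>R T u + (l * t') *\<^sub>R (z - u) - p))\<^sup>2
    \<le> (1 - 2 * t * l) * (norm (u - p))\<^sup>2 + (2 * (t - t') * l * M\<^sup>2 + 4 * M\<^sup>2 * l\<^sup>2)"
proof -
  define w where "w = u - T u + t' *\<^sub>R (u - z)"
  have "0 \<le> M" using assms norm_ge_zero order_trans by blast
  have "norm w \<le> norm (u - T u) + t' * norm (u - z)"
    unfolding w_def by (rule order_trans[OF norm_triangle_ineq]) (use assms in simp)
  also have "\<dots> \<le> M + 1 * M" using assms by (intro add_mono mult_mono) auto
  finally have w_le: "(norm w)\<^sup>2 \<le> 4 * M\<^sup>2"
    using power_mono[of "norm w" "2 * M" 2] by (simp add: power_mult_distrib)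
  have "(u - z) \<bullet> (u - p) \<le> M * M"
    by (rule order_trans[OF norm_cauchy_schwarz]) (use assms \<open>0 \<le> M\<close> in \<open>intro mult_mono, auto\<close>)
  then have cs: "(t - t') * ((u - z) \<bullet> (u - p)) \<le> (t - t') * M\<^sup>2"
    using assms by (intro mult_left_mono) (auto simp: power2_eq_square)
  have "w = ((u - p) - (T u - T p)) + (p - T p) + t' *\<^sub>R (u - z)"
    by (simp add: w_def)
  also have "\<dots> = ((u - p) - (T u - T p)) + t *\<^sub>R (u - p) - (t - t') *\<^sub>R (u - z)"
    unfolding p by (simp add: algebra_simps)
  finally have "w \<bullet> (u - p) = ((u - p) \<bullet> (u - p) - (T u - T p) \<bullet> (u - p))
      + t * ((u - p) \<bullet> (u - p)) - (t - t') * ((u - z) \<bullet> (u - p))"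
    by (simp add: inner_diff_left inner_add_left)
  moreover have "(T u - T p) \<bullet> (u - p) \<le> (u - p) \<bullet> (u - p)"
    using assms unfolding pseudocontraction_on_def by (simp add: power2_norm_eq_inner)
  ultimately have w_ge: "t * (norm (u - p))\<^sup>2 - (t - t') * M\<^sup>2 \<le> w \<bullet> (u - p)"
    using cs by (simp add: power2_norm_eq_inner)
  have v: "(1 - l) *\<^sub>R u + l *\<^sub>R T u + (l * t') *\<^sub>R (z - u) - p = (u - p) - l *\<^sub>R w"
    by (simp add: w_def algebra_simps)
  have "(norm ((1 - l) *\<^sub>R u + l *\<^sub>R T u + (l * t') *\<^sub>R (z - u) - p))\<^sup>2
      = (norm (u - p))\<^sup>2 - 2 * l * (w \<bullet> (u - p)) + l\<^sup>2 * (norm w)\<^sup>2"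
    unfolding v power2_norm_eq_inner
    by (simp add: inner_diff_left inner_diff_right inner_commute power2_eq_square right_diff_distrib)
  also have "\<dots> \<le> (norm (u - p))\<^sup>2 - 2 * l * (t * (norm (u - p))\<^sup>2 - (t - t') * M\<^sup>2) + l\<^sup>2 * (4 * M\<^sup>2)"
    using w_ge w_le \<open>0 \<le> l\<close> by (intro add_mono diff_mono mult_left_mono) auto
  finally show ?thesis by (simp add: algebra_simps)
qed

section \<open>Setting and invariance of \<open>C\<close>\<close>

locale bruck_iteration =
  fixes C :: "'a::real_inner set" and T :: "'a \<Rightarrow> 'a" and M :: nat and z :: 'a
    and x y :: "nat \<Rightarrow> 'a" and lam \<theta> :: "nat \<Rightarrow> real"
    and \<phi>\<^sub>1 \<phi>\<^sub>2 \<phi>\<^sub>3 :: "real \<Rightarrow> nat" and f :: "nat \<Rightarrow> nat" and n\<^sub>0 :: nat and \<delta> :: real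
  assumes bounded_C: "bounded C" and convex_C: "convex C"
    and M_pos: "M > 0" and diameter_C: "diameter C \<le> real M"
    and T_C: "T \<in> C \<rightarrow> C" and pseudo: "pseudocontraction_on C T"
    and x1_C: "x 1 \<in> C" and z_C: "z \<in> C"
    and paired: "acceptably_paired lam \<theta> \<phi>\<^sub>1 \<phi>\<^sub>2 \<phi>\<^sub>3 f n\<^sub>0 \<delta>"
    and lam_theta: "\<forall>n. lam n * (1 + \<theta> n) \<le> 1"
    and y_C: "\<forall>i. y i \<in> C"
    and y_eq: "\<forall>i. y i = (1 / (1 + \<theta> i)) *\<^sub>R T (y i) + (\<theta> i / (1 + \<theta> i)) *\<^sub>R z"
    and x_rec: "\<forall>n\<ge>1. x (n + 1) =
           (1 - lam n) *\<^sub>R x n + lam n *\<^sub>R T (x n) + (lam n * \<theta> n) *\<^sub>R (z - x n)"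
begin

lemma lam_bounds: "0 \<le> lam n" "lam n \<le> 1"
  and theta_bounds: "0 \<le> \<theta> n" "\<theta> n \<le> 1"
  and delta_pos: "0 < \<delta>"
  and theta_antimono: "i \<le> j \<Longrightarrow> \<theta> j \<le> \<theta> i"
  using paired unfolding acceptably_paired_def by (auto dest: decseqD)

lemma theta_le: "0 < \<epsilon> \<Longrightarrow> \<phi>\<^sub>1 \<epsilon> \<le> n \<Longrightarrow> \<theta> n \<le> \<epsilon>"
  and delta_le: "n\<^sub>0 \<le> n \<Longrightarrow> \<delta> \<le> \<theta> (f n) * (\<Sum>j = f n..f (n + 1). lam j)"
  and theta_diff_sum_le:
    "0 < \<epsilon> \<Longrightarrow> \<phi>\<^sub>2 \<epsilon> \<le> n \<Longrightarrow> (\<theta> (f n) - \<theta> (f (n + 1))) * (\<Sum>j = f n..f (n + 1). lam j) \<le> \<epsilon>"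
  and sum_lam_square_le: "0 < \<epsilon> \<Longrightarrow> \<phi>\<^sub>3 \<epsilon> \<le> n \<Longrightarrow> (\<Sum>j = f n..f (n + 1). (lam j)\<^sup>2) \<le> \<epsilon>"
  using paired unfolding acceptably_paired_def by blast+

lemma strict_mono_f: "strict_mono f"
  using paired unfolding acceptably_paired_def strict_mono_Suc_iff by (auto simp: Suc_le_eq)

lemma f_ge: "n \<le> f n"
  using seq_suble[OF strict_mono_f] .

lemma f_mono: "m \<le> n \<Longrightarrow> f m \<le> f n"
  using strict_mono_f by (simp add: strict_mono_less_eq)

lemma norm_diff_le: "u \<in> C \<Longrightarrow> v \<in> C \<Longrightarrow> norm (u - v) \<le> real M"
  using diameter_bounded_bound[OF bounded_C, of u v] diameter_C by (simp add: dist_norm)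

lemma y_residual: "y i - T (y i) = \<theta> i *\<^sub>R (z - y i)"
proof -
  have pos: "1 + \<theta> i > 0" using theta_bounds(1)[of i] by linarith
  have "(1 + \<theta> i) *\<^sub>R y i
      = (1 + \<theta> i) *\<^sub>R ((1 / (1 + \<theta> i)) *\<^sub>R T (y i) + (\<theta> i / (1 + \<theta> i)) *\<^sub>R z)"
    using y_eq by metis
  also have "\<dots> = T (y i) + \<theta> i *\<^sub>R z"
    using pos by (simp add: scaleR_add_right)
  finally show ?thesis by (simp add: algebra_simps)
qed

text \<open>The update is a convex combination, with weight
  \<open>lam n * (1 + \<theta> n) \<le> 1\<close>, of \<open>x n\<close> and a point
  \<open>?v\<close> that itself lies between \<open>T (x n)\<close> and \<open>z\<close>.\<close>

lemma x_C: "1 \<le> n \<Longrightarrow> x n \<in> C"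
proof (induction n rule: nat_induct_at_least)
  case base
  then show ?case by (fact x1_C)
next
  case (Suc n)
  let ?t = "lam n * (1 + \<theta> n)" and ?s = "1 / (1 + \<theta> n)"
  have pos: "1 + \<theta> n > 0" using theta_bounds(1)[of n] by linarith
  let ?v = "?s *\<^sub>R T (x n) + (\<theta> n * ?s) *\<^sub>R z"
  have "?v \<in> C"
    using Suc T_C z_C pos theta_bounds[of n]
    by (intro convexD[OF convex_C]) (auto simp: field_simps)
  then have "(1 - ?t) *\<^sub>R x n + ?t *\<^sub>R ?v \<in> C"
    using Suc lam_theta lam_bounds[of n] theta_bounds[of n]
    by (intro convexD[OF convex_C _ \<open>?v \<in> C\<close>]) auto
  also have "(1 - ?t) *\<^sub>R x n + ?t *\<^sub>R ?v = x (Suc n)"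
  proof -
    have "?t * ?s = lam n" "?t * (\<theta> n * ?s) = lam n * \<theta> n" using pos by auto
    then have "?t *\<^sub>R ?v = lam n *\<^sub>R T (x n) + (lam n * \<theta> n) *\<^sub>R z"
      by (simp only: scaleR_add_right scaleR_scaleR)
    then show ?thesis using x_rec Suc by (simp add: algebra_simps)
  qed
  finally show ?case .
qed

section \<open>Estimates over one block\<close>

text \<open>The reference point stays frozen at the left end of the block, so the one-step errors
  sum to exactly the two quantities that \<open>\<phi>\<^sub>2\<close> and
  \<open>\<phi>\<^sub>3\<close> control.\<close>

lemma block_estimate:
  assumes k: "1 \<le> k" and r: "f k \<le> r" "r \<le> f (k + 1)"
    and B: "\<phi>\<^sub>2 B \<le> k" "0 < B" and E: "\<phi>\<^sub>3 E \<le> k" "0 < E"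
  shows "(norm (x r - y (f k)))\<^sup>2
    \<le> exp (- (2 * \<theta> (f k) * (\<Sum>j = f k..<r. lam j))) * (norm (x (f k) - y (f k)))\<^sup>2
      + (2 * (real M)\<^sup>2 * B + 4 * (real M)\<^sup>2 * E)"
proof -
  let ?D = "\<theta> (f k) - \<theta> (f (k + 1))"
  let ?e = "\<lambda>j. 2 * ?D * lam j * (real M)\<^sup>2 + 4 * (real M)\<^sup>2 * (lam j)\<^sup>2"
  have D: "0 \<le> ?D" using theta_antimono f_mono by simp
  have step: "(norm (x (Suc j) - y (f k)))\<^sup>2
      \<le> (1 - 2 * \<theta> (f k) * lam j) * (norm (x j - y (f k)))\<^sup>2 + ?e j"
    if "f k \<le> j" "j < r" for j
  proof -
    have "1 \<le> j" using that k f_ge[of k] by linarith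
    then have C: "x j \<in> C" "T (x j) \<in> C" using x_C T_C by auto
    have "(norm (x (Suc j) - y (f k)))\<^sup>2 \<le> (1 - 2 * \<theta> (f k) * lam j) * (norm (x j - y (f k)))\<^sup>2
        + (2 * (\<theta> (f k) - \<theta> j) * lam j * (real M)\<^sup>2 + 4 * (real M)\<^sup>2 * (lam j)\<^sup>2)"
      using pseudocontraction_step[OF pseudo, of "x j" "y (f k)" "\<theta> (f k)" z "lam j" "\<theta> j" "real M"]
        C y_C y_residual lam_bounds theta_bounds theta_antimono[OF that(1)] norm_diff_le z_C
        x_rec \<open>1 \<le> j\<close> by simp
    \<comment> \<open>The mismatch at each \<open>j\<close> is at most the total drop of
      \<open>\<theta>\<close> over the block.\<close>
    moreover have "(\<theta> (f k) - \<theta> j) * (lam j * (real M)\<^sup>2) \<le> ?D * (lam j * (real M)\<^sup>2)"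
      using theta_antimono[of j "f (k + 1)"] that r lam_bounds by (intro mult_right_mono) auto
    ultimately show ?thesis by (simp add: algebra_simps)
  qed
  have "(norm (x r - y (f k)))\<^sup>2
      \<le> exp (- (2 * \<theta> (f k) * (\<Sum>j = f k..<r. lam j))) * (norm (x (f k) - y (f k)))\<^sup>2
        + (\<Sum>j = f k..<r. ?e j)"
    using step D lam_bounds theta_bounds r(1) by (intro exp_recursion_bound) auto
  also have "(\<Sum>j = f k..<r. ?e j) \<le> (\<Sum>j = f k..f (k + 1). ?e j)"
    using r D lam_bounds by (intro sum_mono2) auto
  also have "\<dots> = 2 * (real M)\<^sup>2 * (?D * (\<Sum>j = f k..f (k + 1). lam j))
      + 4 * (real M)\<^sup>2 * (\<Sum>j = f k..f (k + 1). (lam j)\<^sup>2)"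
    by (simp only: sum.distrib sum_distrib_left mult_ac)
  also have "\<dots> \<le> 2 * (real M)\<^sup>2 * B + 4 * (real M)\<^sup>2 * E"
    using theta_diff_sum_le[OF B(2,1)] sum_lam_square_le[OF E(2,1)]
    by (intro add_mono mult_left_mono) auto
  finally show ?thesis by simp
qed

lemma block_contraction:
  assumes k: "1 \<le> k" "n\<^sub>0 \<le> k" "\<phi>\<^sub>1 (\<delta> / 2) \<le> k" and e: "0 < e"
    and "\<phi>\<^sub>2 (e\<^sup>2 / (4 * (real M)\<^sup>2)) \<le> k" "\<phi>\<^sub>3 (e\<^sup>2 / (8 * (real M)\<^sup>2)) \<le> k"
  shows "norm (x (f (k + 1)) - y (f k)) \<le> exp (- \<delta> / 2) * norm (x (f k) - y (f k)) + e"
proof -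
  let ?a = "norm (x (f k) - y (f k))" and ?S = "\<Sum>j = f k..<f (k + 1). lam j"
  have le: "f k \<le> f (k + 1)" by (simp add: f_mono)
  \<comment> \<open>The sum in the hypothesis on \<open>\<delta>\<close> includes the right endpoint of the block, the recursion does
      not; the missing term is at most \<open>\<theta> (f k) \<le> \<delta> / 2\<close>.\<close>
  have "\<theta> (f k) * lam (f (k + 1)) \<le> \<theta> (f k) * 1"
    using lam_bounds theta_bounds by (intro mult_left_mono) auto
  also have "\<dots> \<le> \<delta> / 2"
    using theta_le[of "\<delta> / 2" "f k"] delta_pos k f_ge[of k] by simp
  moreover have "\<delta> \<le> \<theta> (f k) * ?S + \<theta> (f k) * lam (f (k + 1))"
  proof -
    have "(\<Sum>j = f k..f (k + 1). lam j) = ?S + lam (f (k + 1))"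
      using le by (simp add: sum.last_plus)
    then show ?thesis using delta_le[OF k(2)] by (simp add: distrib_left)
  qed
  \<comment> \<open>At least \<open>\<delta> / 2\<close> is left for
    \<open>\<theta> (f k) * ?S\<close>; the factor 2 in the exponent restores
    \<open>\<delta>\<close>.\<close>
  ultimately have "exp (- (2 * \<theta> (f k) * ?S)) * ?a\<^sup>2 \<le> exp (- \<delta>) * ?a\<^sup>2"
    by (intro mult_right_mono) auto
  moreover have "2 * (real M)\<^sup>2 * (e\<^sup>2 / (4 * (real M)\<^sup>2)) + 4 * (real M)\<^sup>2 * (e\<^sup>2 / (8 * (real M)\<^sup>2)) = e\<^sup>2"
    using M_pos by (simp add: field_simps)
  ultimately have "(norm (x (f (k + 1)) - y (f k)))\<^sup>2 \<le> exp (- \<delta>) * ?a\<^sup>2 + e\<^sup>2"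
    using block_estimate[OF k(1) le order.refl assms(5) _ assms(6)] e M_pos by simp
  also have "exp (- \<delta>) = (exp (- \<delta> / 2))\<^sup>2"
    by (simp add: power2_eq_square exp_add[symmetric])
  \<comment> \<open>The omitted cross term is nonnegative; this allows taking square roots and
    yields the contraction factor \<open>exp (- \<delta> / 2)\<close>.\<close>
  also have "(exp (- \<delta> / 2))\<^sup>2 * ?a\<^sup>2 + e\<^sup>2 \<le> (exp (- \<delta> / 2) * ?a + e)\<^sup>2"
    using e by (simp add: power2_sum power_mult_distrib)
  finally show ?thesis
    by (rule power2_le_imp_le) (use e in simp)
qed

text \<open>The exponential is at most 1 and each error is a third of \<open>\<eta>\<^sup>2\<close>;
  now \<open>1/16 + 2/3 \<le> 49/64\<close>. Stopping at \<open>7 / 8 * \<eta>\<close> leaves room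
  for the variation of \<open>y\<close> between blocks.\<close>

lemma block_stability:
  assumes "1 \<le> k" and r: "f k \<le> r" "r \<le> f (k + 1)" and "0 < \<eta>"
    and "\<phi>\<^sub>2 (\<eta>\<^sup>2 / (6 * (real M)\<^sup>2)) \<le> k" "\<phi>\<^sub>3 (\<eta>\<^sup>2 / (12 * (real M)\<^sup>2)) \<le> k"
    and close: "norm (x (f k) - y (f k)) \<le> \<eta> / 4"
  shows "norm (x r - y (f k)) \<le> 7 / 8 * \<eta>"
proof -
  let ?a = "norm (x (f k) - y (f k))"
  have "0 \<le> 2 * \<theta> (f k) * (\<Sum>j = f k..<r. lam j)"
    using lam_bounds theta_bounds by (intro mult_nonneg_nonneg sum_nonneg) auto
  then have "exp (- (2 * \<theta> (f k) * (\<Sum>j = f k..<r. lam j))) * ?a\<^sup>2 \<le> 1 * ?a\<^sup>2"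
    by (intro mult_right_mono) auto
  moreover have "?a\<^sup>2 \<le> (\<eta> / 4)\<^sup>2" using close by (intro power_mono) auto
  moreover have "2 * (real M)\<^sup>2 * (\<eta>\<^sup>2 / (6 * (real M)\<^sup>2)) + 4 * (real M)\<^sup>2 * (\<eta>\<^sup>2 / (12 * (real M)\<^sup>2))
      = 2 / 3 * \<eta>\<^sup>2"
    using M_pos by (simp add: field_simps)
  moreover have "0 < \<eta>\<^sup>2 / (6 * (real M)\<^sup>2)" "0 < \<eta>\<^sup>2 / (12 * (real M)\<^sup>2)"
    using \<open>0 < \<eta>\<close> M_pos by auto
  ultimately have "(norm (x r - y (f k)))\<^sup>2 \<le> (\<eta> / 4)\<^sup>2 + 2 / 3 * \<eta>\<^sup>2"
    using block_estimate[OF assms(1) r assms(5) _ assms(6)] by linarith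
  also have "\<dots> \<le> (7 / 8 * \<eta>)\<^sup>2" by (simp add: power2_eq_square)
  finally show ?thesis by (rule power2_le_imp_le) (use \<open>0 < \<eta>\<close> in simp)
qed

section \<open>Metastability of the iteration\<close>

text \<open>After the thresholds collected in \<open>n\<^sub>1\<close>, another \<open>d\<close>
  blocks shrink the initial distance, at most \<open>M\<close>, to \<open>\<eta> / 8\<close>; the
  accumulated errors cost another \<open>\<eta> / 8\<close>. From \<open>K\<close> on, stability
  inside the blocks takes over.\<close>

lemma Phi_rate_correct:
  assumes meta: "metastable_with_rate y \<Psi>" and \<eta>: "0 < \<eta>"
  obtains K where "1 \<le> K" "f K \<le> Phi_rate M \<phi>\<^sub>1 \<phi>\<^sub>2 \<phi>\<^sub>3 f n\<^sub>0 \<delta> \<Psi> \<eta> h"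
    and "\<And>i. i \<in> {f K..f K + h (f K)} \<Longrightarrow> norm (x i - y (f (lower_index f i))) \<le> \<eta>"
    and "\<And>i j. i \<in> {f K..f K + h (f K)} \<Longrightarrow> j \<in> {f K..f K + h (f K)} \<Longrightarrow> norm (x i - x j) \<le> 2 * \<eta>"
proof -
  define c where "c = exp (- \<delta> / 2)"
  define e where "e = (1 - c) / 16 * \<eta>"
  define k\<^sub>0 where "k\<^sub>0 = max (\<phi>\<^sub>2 (\<eta>\<^sup>2 / (6 * (real M)\<^sup>2))) (\<phi>\<^sub>3 (\<eta>\<^sup>2 / (12 * (real M)\<^sup>2)))"
  define d where "d = max (f k\<^sub>0) (nat \<lceil>log c (\<eta> / (8 * real M))\<rceil>)"
  define n\<^sub>1 where "n\<^sub>1 = Max {n\<^sub>0, \<phi>\<^sub>1 (\<delta> / 2), \<phi>\<^sub>2 (e\<^sup>2 / (4 * (real M)\<^sup>2)), \<phi>\<^sub>3 (e\<^sup>2 / (8 * (real M)\<^sup>2))}"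
  define h' where "h' n = lower_index f (f n + h (f n)) - n" for n
  define h\<^sub>d where "h\<^sub>d n = d + n\<^sub>1 + 1 + h' (n + n\<^sub>1 + d + 1)" for n
  define h\<^sub>d\<^sub>f where "h\<^sub>d\<^sub>f n = f (n + h\<^sub>d n) - n" for n
  have Phi: "Phi_rate M \<phi>\<^sub>1 \<phi>\<^sub>2 \<phi>\<^sub>3 f n\<^sub>0 \<delta> \<Psi> \<eta> h = f (\<Psi> e h\<^sub>d\<^sub>f + n\<^sub>1 + d + 1)"
    unfolding Phi_rate_def Let_def h\<^sub>d\<^sub>f_def[abs_def] h\<^sub>d_def[abs_def] h'_def[abs_def]
      n\<^sub>1_def d_def k\<^sub>0_def e_def c_def by (rule refl)
  have c: "0 < c" "c < 1" using delta_pos by (auto simp: c_def)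
  have e: "0 < e" "e \<le> \<eta> / 16" using c \<eta> by (auto simp: e_def)
  have n\<^sub>1: "n\<^sub>0 \<le> n\<^sub>1" "\<phi>\<^sub>1 (\<delta> / 2) \<le> n\<^sub>1" "\<phi>\<^sub>2 (e\<^sup>2 / (4 * (real M)\<^sup>2)) \<le> n\<^sub>1"
    "\<phi>\<^sub>3 (e\<^sup>2 / (8 * (real M)\<^sup>2)) \<le> n\<^sub>1"
    unfolding n\<^sub>1_def by (auto intro!: Max_ge)
  have d_k\<^sub>0: "k\<^sub>0 \<le> d" using f_ge[of k\<^sub>0] by (simp add: d_def)
  have c_d: "c ^ d * real M \<le> \<eta> / 8"
  proof -
    \<comment> \<open>If the logarithm is negative, its truncation to 0 only increases it. As
      \<open>c < 1\<close>, a larger exponent gives a smaller power.\<close>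
    have "log c (\<eta> / (8 * real M)) \<le> real d"
      unfolding d_def by linarith
    then have "c powr real d \<le> c powr log c (\<eta> / (8 * real M))"
      using c by (intro powr_mono') auto
    also have "\<dots> = \<eta> / (8 * real M)" using c \<eta> M_pos by (intro powr_log_cancel) auto
    finally show ?thesis using c M_pos by (simp add: powr_realpow field_simps)
  qed
  obtain N where N: "N \<le> \<Psi> e h\<^sub>d\<^sub>f"
    and yN: "\<And>i j. i \<in> {N..N + h\<^sub>d\<^sub>f N} \<Longrightarrow> j \<in> {N..N + h\<^sub>d\<^sub>f N} \<Longrightarrow> norm (y i - y j) \<le> e"
    using meta e unfolding metastable_with_rate_def by meson
  \<comment> \<open>The summand 1 ensures \<open>f m \<ge> 1\<close>, the first index at which
    \<open>x\<close> is constrained.\<close>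
  define m where "m = N + n\<^sub>1 + 1"
  define K where "K = m + d"
  define L where "L = lower_index f (f K + h (f K))"
  have KL: "K \<le> L" unfolding L_def by (rule lower_index_ge[OF strict_mono_f]) simp
  \<comment> \<open>The shifts in \<open>h\<^sub>d\<close> and the subtraction in \<open>h'\<close>
    cancel, so the stretch on which \<open>y\<close> varies by at most \<open>e\<close> ends exactly
    at \<open>f L\<close>.\<close>
  have "N + h\<^sub>d N = L"
    using KL by (simp add: h\<^sub>d_def h'_def K_def m_def L_def add_ac)
  then have "N + h\<^sub>d\<^sub>f N = f L"
    using f_ge[of L] by (simp add: h\<^sub>d\<^sub>f_def)
  then have y_close: "norm (y (f k) - y (f l)) \<le> e" if "m \<le> k" "k \<le> L" "m \<le> l" "l \<le> L" for k l
    using that yN[of "f k" "f l"] f_mono[of k L] f_mono[of l L] f_ge[of k] f_ge[of l]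
    by (auto simp: m_def)
  have x_y_close: "norm (x (f k) - y (f k)) \<le> \<eta> / 4" if "K \<le> k" "k \<le> L" for k
  proof -
    define b where "b s = norm (x (f (m + s)) - y (f (m + s)))" for s
    \<comment> \<open>One \<open>e\<close> comes from the block contraction, the other from moving
      the reference point to the next block.\<close>
    have "b (Suc s) \<le> c * b s + 2 * e" if "s < L - m" for s
    proof -
      have "norm (x (f (m + s + 1)) - y (f (m + s))) \<le> c * b s + e"
        unfolding b_def c_def using n\<^sub>1 e by (intro block_contraction) (auto simp: m_def)
      moreover have "norm (y (f (m + s)) - y (f (m + s + 1))) \<le> e"
        using that by (intro y_close) auto
      moreover have "b (Suc s) \<le> norm (x (f (m + s + 1)) - y (f (m + s)))
          + norm (y (f (m + s)) - y (f (m + s + 1)))"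
        unfolding b_def using norm_triangle_ineq[of "x (f (m + s + 1)) - y (f (m + s))"
            "y (f (m + s)) - y (f (m + s + 1))"] by simp
      ultimately show ?thesis by linarith
    qed
    moreover have "k - m \<le> L - m" using that by simp
    ultimately have "b (k - m) \<le> c ^ (k - m) * b 0 + 2 * e / (1 - c)"
      using c e geometric_recursion_bound[of c "2 * e" "L - m" b "k - m"] by simp
    moreover have "2 * e / (1 - c) = \<eta> / 8"
      using c by (simp add: e_def field_simps)
    moreover have "c ^ (k - m) * b 0 \<le> c ^ d * real M"
    proof (intro mult_mono)
      show "c ^ (k - m) \<le> c ^ d"
        using c that by (intro power_decreasing) (auto simp: K_def)
      have "1 \<le> f m" using f_ge[of m] by (simp add: m_def)
      then show "b 0 \<le> real M"
        unfolding b_def using x_C y_C by (auto intro: norm_diff_le)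
    qed (use c b_def in auto)
    ultimately have "b (k - m) \<le> \<eta> / 4" using c_d by linarith
    then show ?thesis using that by (simp add: b_def K_def)
  qed
  have index: "K \<le> lower_index f i" "lower_index f i \<le> L" "f (lower_index f i) \<le> i"
    "i \<le> f (lower_index f i + 1)" if "i \<in> {f K..f K + h (f K)}" for i
  proof -
    show "K \<le> lower_index f i" using that lower_index_ge[OF strict_mono_f] by simp
    show le: "f (lower_index f i) \<le> i"
      using that f_mono[of 0 K] by (intro f_lower_index_le[OF strict_mono_f]) auto
    show "lower_index f i \<le> L"
      unfolding L_def using that le by (intro lower_index_ge[OF strict_mono_f]) auto
    show "i \<le> f (lower_index f i + 1)"
      using less_f_Suc_lower_index[OF strict_mono_f, of i] by simp
  qed
  \<comment> \<open>Each \<open>i\<close> lies in a block whose index is between \<open>K\<close>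
    and \<open>L\<close>, and \<open>K \<ge> d \<ge> k\<^sub>0\<close> gives the thresholds for
    stability.\<close>
  have near: "norm (x i - y (f (lower_index f i))) \<le> 7 / 8 * \<eta>" if "i \<in> {f K..f K + h (f K)}" for i
    using index[OF that] \<eta> d_k\<^sub>0 x_y_close
    by (intro block_stability) (auto simp: K_def m_def k\<^sub>0_def)
  show ?thesis
  proof
    show "1 \<le> K" by (simp add: K_def m_def)
    show "f K \<le> Phi_rate M \<phi>\<^sub>1 \<phi>\<^sub>2 \<phi>\<^sub>3 f n\<^sub>0 \<delta> \<Psi> \<eta> h"
      unfolding Phi using N by (intro f_mono) (simp add: K_def m_def)
    show "norm (x i - y (f (lower_index f i))) \<le> \<eta>" if "i \<in> {f K..f K + h (f K)}" for i
      using near[OF that] \<eta> by linarith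
    show "norm (x i - x j) \<le> 2 * \<eta>"
      if ij: "i \<in> {f K..f K + h (f K)}" "j \<in> {f K..f K + h (f K)}" for i j
    proof -
      let ?p = "y (f (lower_index f i))" and ?q = "y (f (lower_index f j))"
      have "norm (?p - ?q) \<le> e"
        using index[OF ij(1)] index[OF ij(2)] by (intro y_close) (auto simp: K_def)
      moreover have "norm (x i - x j) \<le> norm (x i - ?p) + norm (?p - ?q) + norm (x j - ?q)"
        by norm
      \<comment> \<open>The count is \<open>7/8 + 1/16 + 7/8 \<le> 2\<close>.\<close>
      ultimately show ?thesis using near[OF ij(1)] near[OF ij(2)] e \<eta> by linarith
    qed
  qed
qed

section \<open>Asymptotic regularity and the final rate\<close>

text \<open>Shifting the stretch by \<open>b\<close> makes \<open>\<theta>\<close> small at the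
  reference points, and \<open>h\<close> is long enough to contain the shifted stretch. The residual
  of \<open>x i\<close> then splits into three parts, each at most
  \<open>\<epsilon> / 3\<close>.\<close>

lemma Delta_rate_correct:
  assumes meta: "metastable_with_rate y \<Psi>" and \<omega>: "uniform_continuity_modulus_on C T \<omega>"
    and \<epsilon>: "0 < \<epsilon>"
  shows "\<exists>n. 1 \<le> n \<and> n \<le> Delta_rate M \<omega> \<phi>\<^sub>1 \<phi>\<^sub>2 \<phi>\<^sub>3 f n\<^sub>0 \<delta> \<Psi> g \<epsilon> \<and>
             (\<forall>i\<in>{n..n + g n}. \<forall>j\<in>{n..n + g n}.
                norm (x i - x j) \<le> \<epsilon> \<and> norm (x i - T (x i)) \<le> \<epsilon>)"
proof -
  define \<epsilon>' where "\<epsilon>' = \<epsilon> / (3 * real M)"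
  define \<eta> where "\<eta> = min (\<epsilon> / 3) (\<omega> \<epsilon>')"
  define b where "b = f (lower_index f (\<phi>\<^sub>1 \<epsilon>') + 1)"
  define h where "h n = b + g (n + b)" for n
  have Delta: "Delta_rate M \<omega> \<phi>\<^sub>1 \<phi>\<^sub>2 \<phi>\<^sub>3 f n\<^sub>0 \<delta> \<Psi> g \<epsilon> = Phi_rate M \<phi>\<^sub>1 \<phi>\<^sub>2 \<phi>\<^sub>3 f n\<^sub>0 \<delta> \<Psi> \<eta> h + b"
    unfolding Delta_rate_def Let_def \<eta>_def h_def[abs_def] b_def \<epsilon>'_def by (rule refl)
  have M: "1 \<le> real M" using M_pos by simp
  have \<epsilon>': "0 < \<epsilon>'" "\<epsilon>' * real M = \<epsilon> / 3" using \<epsilon> M by (auto simp: \<epsilon>'_def)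
  \<comment> \<open>Here \<open>M\<close> being a positive integer matters, as it gives
    \<open>M \<ge> 1\<close>.\<close>
  then have \<epsilon>'_le: "\<epsilon>' \<le> \<epsilon> / 3" using mult_left_mono[OF M, of \<epsilon>'] by linarith
  have \<eta>: "0 < \<eta>" "\<eta> \<le> \<epsilon> / 3" "\<eta> \<le> \<omega> \<epsilon>'"
    using \<epsilon> \<epsilon>' \<omega> by (auto simp: \<eta>_def uniform_continuity_modulus_on_def)
  obtain K where K: "1 \<le> K" "f K \<le> Phi_rate M \<phi>\<^sub>1 \<phi>\<^sub>2 \<phi>\<^sub>3 f n\<^sub>0 \<delta> \<Psi> \<eta> h"
    and near: "\<And>i. i \<in> {f K..f K + h (f K)} \<Longrightarrow> norm (x i - y (f (lower_index f i))) \<le> \<eta>"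
    and cauchy: "\<And>i j. i \<in> {f K..f K + h (f K)} \<Longrightarrow> j \<in> {f K..f K + h (f K)} \<Longrightarrow>
      norm (x i - x j) \<le> 2 * \<eta>"
    by (rule Phi_rate_correct[OF meta \<eta>(1), where h = h]) (rule that; blast)
  define n where "n = f K + b"
  have n: "1 \<le> n" using K(1) f_ge[of K] by (simp add: n_def)
  have sub: "i \<in> {f K..f K + h (f K)}" if "i \<in> {n..n + g n}" for i
    using that by (auto simp: n_def h_def)
  have residual: "norm (x i - T (x i)) \<le> \<epsilon>" if i: "i \<in> {n..n + g n}" for i
  proof -
    define k where "k = f (lower_index f i)"
    have "b \<le> i" using i by (simp add: n_def)
    \<comment> \<open>As \<open>b\<close> is itself a value of \<open>f\<close>, rounding
      \<open>i\<close> down to a block start cannot fall below \<open>b\<close>.\<close>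
    then have "b \<le> k"
      unfolding k_def b_def by (intro f_mono lower_index_ge[OF strict_mono_f])
    moreover have "\<phi>\<^sub>1 \<epsilon>' < b"
      using less_f_Suc_lower_index[OF strict_mono_f] by (simp add: b_def)
    ultimately have "\<theta> k \<le> \<epsilon>'" using \<epsilon>' by (intro theta_le) auto
    then have "\<theta> k * norm (z - y k) \<le> \<epsilon>' * real M"
      using \<epsilon>' z_C y_C by (intro mult_mono norm_diff_le) auto
    then have "norm (y k - T (y k)) \<le> \<epsilon> / 3"
      using \<epsilon>' theta_bounds by (simp add: y_residual)
    moreover have xy: "norm (x i - y k) \<le> \<eta>" using near[OF sub[OF i]] by (simp add: k_def)
    moreover have "norm (T (x i) - T (y k)) \<le> \<epsilon>'"
    proof -
      have "x i \<in> C" "y k \<in> C" using x_C y_C i n by auto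
      then show ?thesis
        using \<omega> \<epsilon>'(1) xy \<eta>(3) unfolding uniform_continuity_modulus_on_def by auto
    qed
    moreover have "norm (x i - T (x i))
        \<le> norm (x i - y k) + norm (y k - T (y k)) + norm (T (x i) - T (y k))"
      by norm
    ultimately show ?thesis using \<eta>(2) \<epsilon>'_le by linarith
  qed
  have "norm (x i - x j) \<le> \<epsilon>" if "i \<in> {n..n + g n}" "j \<in> {n..n + g n}" for i j
    using cauchy[OF sub[OF that(1)] sub[OF that(2)]] \<eta> by linarith
  then show ?thesis
    using n residual K(2) by (intro exI[of _ n]) (auto simp: Delta n_def)
qed

end

text \<open>The conclusion includes \<open>1 \<le> n\<close> because the iteration starts at index 1
  and \<open>x 0\<close> is arbitrary.\<close>

theorem theorem3p11:
  fixes C :: "'a::{real_inner, complete_space} set"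
    and T :: "'a \<Rightarrow> 'a"
    and M :: nat
    and \<omega> :: "real \<Rightarrow> real"
    and z :: 'a
    and x y :: "nat \<Rightarrow> 'a"
    and lam \<theta> :: "nat \<Rightarrow> real"
    and \<phi>\<^sub>1 \<phi>\<^sub>2 \<phi>\<^sub>3 :: "real \<Rightarrow> nat"
    and f :: "nat \<Rightarrow> nat"
    and n\<^sub>0 :: nat
    and \<delta> :: real
    and \<Psi> :: "real \<Rightarrow> (nat \<Rightarrow> nat) \<Rightarrow> nat"
  assumes "C \<noteq> {}" and "bounded C" and "closed C" and "convex C"
    and "M > 0" and "diameter C \<le> real M"
    and "T \<in> C \<rightarrow> C"
    and "demicontinuous_on C T"
    and "pseudocontraction_on C T"
    and "uniform_continuity_modulus_on C T \<omega>"
    and "x 1 \<in> C" and "z \<in> C"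
    and "acceptably_paired lam \<theta> \<phi>\<^sub>1 \<phi>\<^sub>2 \<phi>\<^sub>3 f n\<^sub>0 \<delta>"
    and "\<forall>n. lam n * (1 + \<theta> n) \<le> 1"
    and "\<forall>i. y i \<in> C"
    and "\<forall>i. y i = (1 / (1 + \<theta> i)) *\<^sub>R T (y i) + (\<theta> i / (1 + \<theta> i)) *\<^sub>R z"
    and "metastable_with_rate y \<Psi>"
    and "\<forall>n\<ge>1. x (n + 1) =
           (1 - lam n) *\<^sub>R x n + lam n *\<^sub>R T (x n) + (lam n * \<theta> n) *\<^sub>R (z - x n)"
  shows "\<forall>\<epsilon>>0. \<forall>g :: nat \<Rightarrow> nat.
           \<exists>n. 1 \<le> n \<and> n \<le> Delta_rate M \<omega> \<phi>\<^sub>1 \<phi>\<^sub>2 \<phi>\<^sub>3 f n\<^sub>0 \<delta> \<Psi> g \<epsilon> \<and>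
             (\<forall>i\<in>{n..n + g n}. \<forall>j\<in>{n..n + g n}.
                norm (x i - x j) \<le> \<epsilon> \<and> norm (x i - T (x i)) \<le> \<epsilon>)"
proof -
  interpret bruck_iteration C T M z x y lam \<theta> \<phi>\<^sub>1 \<phi>\<^sub>2 \<phi>\<^sub>3 f n\<^sub>0 \<delta>
    by unfold_locales (fact assms)+
  show ?thesis using Delta_rate_correct assms by blast
qed

end
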